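(* Let $P\subset\mathbb{R}^d$ be a full-dimensional convex polytope with $0\in\operatorname{int}(P)$ and vertices $v_1,\dots,v_n$, and let $\Phi:=(v_1,\dots,v_n)\in\mathbb{R}^{d\times n}$ be the matrix with the vertices as columns. Let $\mathfrak{c}\colon V\,\dot\cup\,E\to\mathbb{R}$ be a coloring of the edge-graph $G_P=(V,E)$ such that $G_P^{\mathfrak{c}}$ is at least as symmetric as $P$ (i.e., $\sigma_T\in\operatorname{Aut}(G_P^{\mathfrak{c}})$ for every $T\in\operatorname{Aut}_{\mathrm{GL}}(P)$). If $U:=\operatorname{span}\Phi^\dagger\subseteq\mathbb{R}^n$ is an eigenspace of the colored adjacency matrix $A^{\mathfrak{c}}$, then $\mathfrak{c}$ captures the linear symmetries of $P$; that is, the natural homomorphism $\phi^{\mathfrak{c}}\colon \operatorname{Aut}_{\mathrm{GL}}(P)\to\operatorname{Aut}(G_P^{\mathfrak{c}})$, $T\mapsto\sigma_T$, is a group isomorphism.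
   Context: A polytope is the convex hull of finitely many points; full-dimensional means not contained in a proper affine subspace of $\mathbb{R}^d$. The edge-graph $G_P=(V,E)$ is the simple graph with $V=\{1,\dots,n\}$ and $ij\in E$ iff $\operatorname{conv}\{v_i,v_j\}$ is an edge (1-dimensional face) of $P$. $\operatorname{Aut}_{\mathrm{GL}}(P):=\{T\in\mathrm{GL}(\mathbb{R}^d)\mid TP=P\}$. $\operatorname{Aut}(G_P)$ is the group of permutations $\sigma$ of $V$ with $ij\in E\Leftrightarrow\sigma(i)\sigma(j)\in E$. Each $T\in\operatorname{Aut}_{\mathrm{GL}}(P)$ induces $\sigma_T\in\operatorname{Aut}(G_P)$ by $Tv_i=v_{\sigma_T(i)}$ for all $i\in V$. For a coloring $\mathfrak{c}\colon V\,\dot\cup\,E\to\mathbb{R}$, $G_P^{\mathfrak{c}}$ denotes the colored graph, and $\operatorname{Aut}(G_P^{\mathfrak{c}})$ is the group of all $\sigma\in\operatorname{Aut}(G_P)$ with $\mathfrak{c}(i)=\mathfrak{c}(\sigma(i))$ for all $i\in V$ and $\mathfrak{c}(ij)=\mathfrak{c}(\sigma(i)\sigma(j))$ for all $ij\in E$. The colored adjacency matrix $A^{\mathfrak{c}}\in\mathbb{R}^{n\times n}$ has entries $A^{\mathfrak{c}}_{ii}=\mathfrak{c}(i)$, $A^{\mathfrak{c}}_{ij}=\mathfrak{c}(ij)$ if $ij\in E$, and $A^{\mathfrak{c}}_{ij}=0$ otherwise. $\Phi^\dagger\in\mathbb{R}^{n\times d}$ is the Moore–Penrose pseudo-inverse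 of $\Phi$ (so $\Phi\Phi^\dagger=\mathrm{Id}_d$ and $\Phi^\dagger\Phi$ is the orthogonal projector onto $U$), and $\operatorname{span}\Phi^\dagger$ is its column span. "Eigenspace" means the full eigenspace $\ker(A^{\mathfrak{c}}-\lambda\,\mathrm{Id})$ for some eigenvalue $\lambda$. *)

theory Defs
  imports "HOL-Analysis.Analysis" "HOL-Algebra.Group"
begin

definition Aut_GL :: "(real^'d) set \<Rightarrow> (real^'d \<Rightarrow> real^'d) monoid" where
  "Aut_GL P = \<lparr>carrier = {T. linear T \<and> bij T \<and> T ` P = P}, mult = (\<circ>), one = id\<rparr>"

text \<open>The vertices of \<open>P\<close> are enumerated by \<open>v\<close>, so the finite type \<open>'n\<close> plays the role
  of \<open>V = {1, ..., n}\<close>.  Edges of the graph are two-element sets of indices.\<close>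

definition edge_graph :: "(real^'d) set \<Rightarrow> ('n \<Rightarrow> real^'d) \<Rightarrow> 'n set set" where
  "edge_graph P v = {{i, j} | i j. i \<noteq> j \<and> (convex hull {v i, v j}) edge_of P}"

definition graph_automorphisms :: "'n set set \<Rightarrow> ('n \<Rightarrow> 'n) set" where
  "graph_automorphisms E = {\<sigma>. bij \<sigma> \<and> (\<forall>i j. {i, j} \<in> E \<longleftrightarrow> {\<sigma> i, \<sigma> j} \<in> E)}"

text \<open>A coloring of the disjoint union of \<open>V\<close> and \<open>E\<close> is a function on \<open>'n + 'n set\<close>: \<open>Inl i\<close>
  is the vertex \<open>i\<close> and \<open>Inr e\<close> the edge \<open>e\<close>.  Its values at \<open>Inr e\<close> with \<open>e \<notin> E\<close> are
  never used.\<close>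

definition Aut_colored :: "'n set set \<Rightarrow> ('n + 'n set \<Rightarrow> real) \<Rightarrow> ('n \<Rightarrow> 'n) monoid" where
  "Aut_colored E c =
     \<lparr>carrier = {\<sigma> \<in> graph_automorphisms E.
        (\<forall>i. c (Inl i) = c (Inl (\<sigma> i))) \<and>
        (\<forall>i j. {i, j} \<in> E \<longrightarrow> c (Inr {i, j}) = c (Inr {\<sigma> i, \<sigma> j}))},
      mult = (\<circ>), one = id\<rparr>"

definition colored_adjacency :: "'n set set \<Rightarrow> ('n + 'n set \<Rightarrow> real) \<Rightarrow> real^'n^'n" where
  "colored_adjacency E c =
     (\<chi> i j. if i = j then c (Inl i) else if {i, j} \<in> E then c (Inr {i, j}) else 0)"

definition induced_perm :: "('n \<Rightarrow> real^'d) \<Rightarrow> (real^'d \<Rightarrow> real^'d) \<Rightarrow> 'n \<Rightarrow> 'n" where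
  "induced_perm v T = (THE \<sigma>. \<forall>i. T (v i) = v (\<sigma> i))"

definition vertex_matrix :: "('n \<Rightarrow> real^'d) \<Rightarrow> real^'n^'d" where
  "vertex_matrix v = (\<chi> k i. v i $ k)"

text \<open>The four Penrose conditions.\<close>

definition is_pinv :: "real^'n^'d \<Rightarrow> real^'d^'n \<Rightarrow> bool" where
  "is_pinv A X \<longleftrightarrow>
     A ** X ** A = A \<and> X ** A ** X = X \<and>
     transpose (A ** X) = A ** X \<and> transpose (X ** A) = X ** A"

definition pinv :: "real^'n^'d \<Rightarrow> real^'d^'n" where
  "pinv A = (THE X. is_pinv A X)"

definition eigenspace :: "real^'n^'n \<Rightarrow> real \<Rightarrow> (real^'n) set" where
  "eigenspace A \<theta> = {x. (A - mat \<theta>) *v x = 0}"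

definition is_eigenvalue :: "real^'n^'n \<Rightarrow> real \<Rightarrow> bool" where
  "is_eigenvalue A \<theta> \<longleftrightarrow> (\<exists>x. x \<noteq> 0 \<and> A *v x = \<theta> *\<^sub>R x)"

text \<open>The definite descriptions and the two group structures above are well behaved.\<close>

lemma is_pinv_unique:
  assumes "is_pinv A X" "is_pinv A Y"
  shows "X = Y"
proof -
  have X: "A ** X ** A = A" "X ** A ** X = X" "transpose (A ** X) = A ** X" "transpose (X ** A) = X ** A"
   and Y: "A ** Y ** A = A" "Y ** A ** Y = Y" "transpose (A ** Y) = A ** Y" "transpose (Y ** A) = Y ** A"
    using assms by (auto simp: is_pinv_def)
  have 1: "A ** X = A ** Y"
  proof -
    have "A ** X = transpose ((A ** Y) ** (A ** X))"
      using X(3) Y(1) by (simp add: matrix_mul_assoc)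
    also have "\<dots> = (A ** X) ** (A ** Y)"
      using X(3) Y(3) by (simp add: matrix_transpose_mul[of "A ** Y" "A ** X"])
    also have "\<dots> = A ** Y"
      using X(1) by (simp add: matrix_mul_assoc)
    finally show ?thesis .
  qed
  have 2: "X ** A = Y ** A"
  proof -
    have "X ** A = transpose ((X ** A) ** (Y ** A))"
      using X(4) Y(1) by (metis matrix_mul_assoc)
    also have "\<dots> = (Y ** A) ** (X ** A)"
      using X(4) Y(4) by (simp add: matrix_transpose_mul[of "X ** A" "Y ** A"])
    also have "\<dots> = Y ** A"
      using X(1) by (metis matrix_mul_assoc)
    finally show ?thesis .
  qed
  have "X = X ** (A ** X)" using X(2) by (simp add: matrix_mul_assoc)
  also have "\<dots> = Y ** A ** Y" using 1 2 by (simp add: matrix_mul_assoc)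
  finally show ?thesis using Y(2) by simp
qed

lemma is_pinv_pinv: "is_pinv A X \<Longrightarrow> is_pinv A (pinv A)"
  unfolding pinv_def by (rule theI[of "is_pinv A" X]) (auto intro: is_pinv_unique)

lemma is_pinv_full_row_rank:
  assumes "(A ** transpose A) ** C = mat 1"
  shows "is_pinv A (transpose A ** C)"
proof -
  define B where "B = A ** transpose A"
  have BC: "B ** C = mat 1" using assms by (simp add: B_def)
  have tB: "transpose B = B" by (simp add: B_def matrix_transpose_mul)
  have CB: "transpose C ** B = mat 1"
    using arg_cong[OF BC, of transpose] by (simp add: matrix_transpose_mul tB transpose_mat)
  have "transpose C = transpose C ** (B ** C)" by (simp add: BC)
  also have "\<dots> = C" using CB by (simp add: matrix_mul_assoc)
  finally have tC: "transpose C = C" .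
  have AX: "A ** (transpose A ** C) = mat 1"
    using BC by (simp add: B_def matrix_mul_assoc)
  have "(transpose A ** C) ** A ** (transpose A ** C)
      = (transpose A ** C) ** (A ** (transpose A ** C))"
    by (simp only: matrix_mul_assoc)
  moreover have "transpose ((transpose A ** C) ** A) = (transpose A ** C) ** A"
    by (simp add: matrix_transpose_mul tC matrix_mul_assoc)
  ultimately show ?thesis
    unfolding is_pinv_def by (simp only: AX transpose_mat matrix_mul_lid matrix_mul_rid simp_thms)
qed

lemma induced_perm_eqI:
  assumes "inj v" "\<And>i. T (v i) = v (\<sigma> i)"
  shows "induced_perm v T = \<sigma>"
  unfolding induced_perm_def
proof (rule the_equality)
  fix \<tau> assume "\<forall>i. T (v i) = v (\<tau> i)"
  then show "\<tau> = \<sigma>" using assms by (auto simp: fun_eq_iff inj_def)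
qed (use assms in auto)

lemma induced_perm_vertex:
  assumes v: "bij_betw v UNIV {x. x extreme_point_of P}" and T: "T \<in> carrier (Aut_GL P)"
  shows "T (v i) = v (induced_perm v T i)"
proof -
  have T': "linear T" "inj T" "T ` P = P" using T by (auto simp: Aut_GL_def bij_is_inj)
  have "\<exists>j. T (v i) = v j" for i
  proof -
    have "v i extreme_point_of P" using v by (auto simp: bij_betw_def)
    then have "T (v i) extreme_point_of P"
      using face_of_linear_image[OF T'(1,2), of "{v i}" P] T'(3)
      by (simp add: face_of_singleton)
    then show ?thesis using v by (auto simp: bij_betw_def image_iff set_eq_iff)
  qed
  then obtain \<sigma> where \<sigma>: "\<And>i. T (v i) = v (\<sigma> i)" by metis
  have "inj v" using v by (simp add: bij_betw_def)
  then have "induced_perm v T = \<sigma>" by (rule induced_perm_eqI) (rule \<sigma>)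
  then show ?thesis by (simp add: \<sigma>)
qed

lemma group_Aut_GL: "group (Aut_GL P)"
proof (rule groupI, goal_cases)
  case (5 T)
  then have T: "linear T" "bij T" "T ` P = P" by (auto simp: Aut_GL_def)
  have "linear (inv_into UNIV T)"
    using T by (metis bij_betw_def inj_linear_imp_inv_linear)
  moreover have "bij (inv_into UNIV T)" by (rule bij_imp_bij_inv[OF T(2)])
  moreover have "inv_into UNIV T ` P = P" by (metis T(2,3) bij_is_inj image_inv_f_f)
  moreover have "inv_into UNIV T \<circ> T = id" using T(2) by (simp add: bij_is_inj)
  ultimately show ?case by (auto simp: Aut_GL_def intro!: exI[of _ "inv_into UNIV T"])
next
  case (1 S T)
  then show ?case by (simp add: Aut_GL_def linear_compose bij_comp image_comp[symmetric] del: o_apply)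
next
  case 2
  show ?case using linear_id by (simp add: Aut_GL_def)
qed (simp_all add: Aut_GL_def o_assoc)

lemma carrier_Aut_colored:
  "\<sigma> \<in> carrier (Aut_colored E c) \<longleftrightarrow>
     bij \<sigma> \<and> (\<forall>i j. {i, j} \<in> E \<longleftrightarrow> {\<sigma> i, \<sigma> j} \<in> E) \<and>
     (\<forall>i. c (Inl i) = c (Inl (\<sigma> i))) \<and>
     (\<forall>i j. {i, j} \<in> E \<longrightarrow> c (Inr {i, j}) = c (Inr {\<sigma> i, \<sigma> j}))"
  unfolding Aut_colored_def graph_automorphisms_def
  by (simp only: partial_object.select_convs mem_Collect_eq conj_assoc)

lemma group_Aut_colored: "group (Aut_colored E c)"
proof (rule groupI, goal_cases)
  case (1 x y)
  then have "bij (x \<circ> y)" by (simp only: carrier_Aut_colored bij_comp)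
  with 1 have "x \<circ> y \<in> carrier (Aut_colored E c)"
    unfolding carrier_Aut_colored o_apply by metis
  then show ?case by (simp add: Aut_colored_def)
next
  case 2
  have "id \<in> carrier (Aut_colored E c)" by (simp add: carrier_Aut_colored)
  then show ?case by (simp add: Aut_colored_def)
next
  case (5 s)
  define t where "t = inv_into UNIV s"
  have b: "bij s" using 5 by (simp only: carrier_Aut_colored)
  have st: "s (t i) = i" for i using b by (simp add: t_def bij_is_surj surj_f_inv_f)
  have "bij t" unfolding t_def by (rule bij_imp_bij_inv[OF b])
  with 5 st have "t \<in> carrier (Aut_colored E c)"
    unfolding carrier_Aut_colored by metis
  moreover have "t \<circ> s = id" using b by (simp add: t_def bij_is_inj)
  ultimately show ?case by (intro bexI[of _ t]) (simp_all add: Aut_colored_def)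
qed (simp_all add: Aut_colored_def o_assoc)

end

theory Submission
  imports Defs
begin

text \<open>The column span of \<open>\<Phi>\<^sup>\<dagger>\<close> equals the row space of \<open>\<Phi>\<close>, that is the space of
  vectors \<open>(w \<bullet> v\<^sub>i)\<^sub>i\<close>.  A colored automorphism \<open>\<sigma>\<close> permutes the coordinates of an eigenvector
  of the adjacency matrix into another eigenvector of the same eigenvalue, so it maps this space to
  itself.  Applied to the \<open>k\<close>-th row of \<open>\<Phi>\<close>, this yields \<open>w\<^sub>k\<close> with
  \<open>(v\<^bsub>\<sigma> i\<^esub>)\<^sub>k = w\<^sub>k \<bullet> v\<^sub>i\<close> for all \<open>i\<close>, and the linear map with rows \<open>w\<^sub>k\<close> induces \<open>\<sigma>\<close>.\<close>

lemma range_matrix_vector_mult: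
  fixes A :: "real^'n^'m"
  shows "range ((*v) A) = span (columns A)"
proof -
  have "span (columns A) \<subseteq> range ((*v) A)"
  proof (rule span_minimal)
    show "columns A \<subseteq> range ((*v) A)"
      by (auto simp: columns_def simp flip: matrix_vector_mult_basis)
    show "subspace (range ((*v) A))"
      by (intro linear_subspace_image matrix_vector_mul_linear subspace_UNIV)
  qed
  then show ?thesis using matrix_vector_mult_in_columnspace[of A] by blast
qed

text \<open>Symmetry of \<open>X ** A\<close> turns \<open>X = X A X\<close> and
  \<open>A = A X A\<close> into factorizations \<open>X = transpose A ** _\<close> and
  \<open>transpose A = X ** _\<close>, so each range contains the other.\<close>

lemma is_pinv_range:
  assumes "is_pinv A X"
  shows "range ((*v) X) = range ((*v) (transpose A))"
proof -
  have "X = X ** A ** X" "A = A ** X ** A" and s: "transpose (X ** A) = X ** A"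
    using assms by (auto simp: is_pinv_def)
  then have "X = transpose A ** (transpose X ** X)"
    by (metis matrix_transpose_mul matrix_mul_assoc)
  moreover have "transpose A = X ** (A ** transpose A)"
    using \<open>A = A ** X ** A\<close> s by (metis matrix_transpose_mul matrix_mul_assoc)
  ultimately have "X *v x \<in> range ((*v) (transpose A))" "transpose A *v y \<in> range ((*v) X)" for x y
    by (metis matrix_vector_mul_assoc rangeI)+
  then show ?thesis by blast
qed

text \<open>Since \<open>pinv\<close> is a definite description, its Penrose conditions become
  available only once some pseudo-inverse is exhibited. Full row rank makes the Gram matrix
  \<open>A ** transpose A\<close> invertible, and \<open>transpose A\<close> times its inverse is
  one.\<close>

lemma ex_is_pinv_of_surj:
  fixes A :: "real^'n^'d"
  assumes "span (columns A) = UNIV"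
  shows "\<exists>X. is_pinv A X"
proof -
  have "x = 0" if "(A ** transpose A) *v x = 0" for x
  proof -
    have "(transpose A *v x) \<bullet> (transpose A *v x) = x \<bullet> ((A ** transpose A) *v x)"
      by (simp add: dot_lmul_matrix flip: matrix_vector_mul_assoc)
    with that have 0: "transpose A *v x = 0" by simp
    \<comment> \<open>Surjectivity of \<open>A\<close> makes the kernel of
      \<open>transpose A\<close> trivial.\<close>
    obtain y where "A *v y = x"
      using assms range_matrix_vector_mult[of A] by (metis UNIV_I imageE)
    then have "x \<bullet> x = (transpose A *v x) \<bullet> y"
      by (simp add: dot_lmul_matrix)
    with 0 show "x = 0" by simp
  qed
  then obtain C where "C ** (A ** transpose A) = mat 1"
    using matrix_left_invertible_ker by blast
  then show ?thesis
    using is_pinv_full_row_rank matrix_left_right_inverse by blast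
qed

text \<open>Preserving vertex colors, edges and edge colors means preserving every matrix entry, so
  the matrix commutes with the permutation of coordinates by \<open>\<sigma>\<close>.\<close>

lemma eigenspace_permute:
  assumes s: "\<sigma> \<in> carrier (Aut_colored E c)"
    and x: "x \<in> eigenspace (colored_adjacency E c) \<theta>"
  shows "(\<chi> i. x $ \<sigma> i) \<in> eigenspace (colored_adjacency E c) \<theta>"
proof -
  let ?A = "colored_adjacency E c"
  have b: "bij \<sigma>" using s by (simp only: carrier_Aut_colored)
  have "?A $ \<sigma> i $ \<sigma> j = ?A $ i $ j" for i j
  proof -
    have "\<sigma> i = \<sigma> j \<longleftrightarrow> i = j" "{\<sigma> i, \<sigma> j} \<in> E \<longleftrightarrow> {i, j} \<in> E" "c (Inl (\<sigma> i)) = c (Inl i)"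
      "{i, j} \<in> E \<Longrightarrow> c (Inr {\<sigma> i, \<sigma> j}) = c (Inr {i, j})"
      using s b unfolding carrier_Aut_colored by (metis bij_is_inj inj_eq)+
    then show ?thesis by (auto simp: colored_adjacency_def)
  qed
  \<comment> \<open>Reindexing along \<open>\<sigma>\<close> turns row \<open>i\<close> against the
    permuted vector into row \<open>\<sigma> i\<close> against \<open>x\<close>.\<close>
  then have "(\<Sum>j\<in>UNIV. ?A $ i $ j * x $ \<sigma> j) = (\<Sum>j\<in>UNIV. ?A $ \<sigma> i $ j * x $ j)" for i
    using sum.reindex_bij_betw[OF b, of "\<lambda>j. ?A $ \<sigma> i $ j * x $ j"] by simp
  moreover have "(?A - mat \<theta>) *v y = 0 \<longleftrightarrow> (\<forall>i. (\<Sum>j\<in>UNIV. ?A $ i $ j * y $ j) = \<theta> * y $ i)" for y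
    by (simp add: vec_eq_iff matrix_vector_mult_def mat_def left_diff_distrib sum_subtractf
        if_distrib[of "\<lambda>t. t * _"] cong: if_cong)
  ultimately show ?thesis
    using x by (simp add: eigenspace_def)
qed

lemma ex_linear_permuting:
  fixes v :: "'n::finite \<Rightarrow> real^'d"
  assumes span: "span (range v) = UNIV"
    and U: "span (columns (pinv (vertex_matrix v))) = eigenspace (colored_adjacency E c) \<theta>"
    and s: "\<sigma> \<in> carrier (Aut_colored E c)"
  shows "\<exists>T. linear T \<and> (\<forall>i. T (v i) = v (\<sigma> i))"
proof -
  have col: "columns (vertex_matrix v) = range v"
    by (auto simp: columns_def column_def vertex_matrix_def)
  have "is_pinv (vertex_matrix v) (pinv (vertex_matrix v))"
    using ex_is_pinv_of_surj[of "vertex_matrix v"] col span is_pinv_pinv by metis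
  then have "range ((*v) (pinv (vertex_matrix v))) = range ((*v) (transpose (vertex_matrix v)))"
    by (rule is_pinv_range)
  moreover have "transpose (vertex_matrix v) *v w = (\<chi> i. w \<bullet> v i)" for w
    by (simp add: vec_eq_iff matrix_vector_mult_def transpose_def vertex_matrix_def inner_vec_def
        mult.commute)
  ultimately have rows: "eigenspace (colored_adjacency E c) \<theta> = range (\<lambda>w. \<chi> i. w \<bullet> v i)"
    using U by (simp add: range_matrix_vector_mult[symmetric])
  have "\<exists>w. \<forall>i. v (\<sigma> i) $ k = w \<bullet> v i" for k
  proof -
    \<comment> \<open>The \<open>k\<close>-th standard basis vector produces the \<open>k\<close>-th
      row of the vertex matrix.\<close>
    have "(\<chi> i. axis k 1 \<bullet> v i) \<in> eigenspace (colored_adjacency E c) \<theta>"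
      unfolding rows by blast
    from eigenspace_permute[OF s this] show ?thesis
      unfolding rows by (auto simp: vec_eq_iff inner_axis')
  qed
  then obtain w where "\<And>k i. v (\<sigma> i) $ k = w k \<bullet> v i" by metis
  then have "linear (\<lambda>x. \<chi> k. w k \<bullet> x) \<and> (\<forall>i. (\<chi> k. w k \<bullet> v i) = v (\<sigma> i))"
    by (auto simp: vec_eq_iff inner_add_right intro!: linearI)
  then show ?thesis by blast
qed

text \<open>\<open>T\<close> maps the spanning set of vertices onto itself, so it is surjective and
  hence bijective by finite dimension. It fixes \<open>P\<close> because linear maps commute with
  convex hulls.\<close>

lemma linear_permuting_vertices_in_Aut_GL:
  fixes P :: "(real^'d) set" and v :: "'n \<Rightarrow> real^'d"
  assumes P: "P = convex hull range v" and span: "span (range v) = UNIV"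
    and T: "linear T" "\<And>i. T (v i) = v (\<sigma> i)" and s: "bij \<sigma>"
  shows "T \<in> carrier (Aut_GL P)"
proof -
  have im: "T ` range v = range v"
    using T(2) bij_is_surj[OF s] by (simp add: image_image) (metis image_image)
  have "range T = span (T ` range v)"
    using linear_span_image[OF T(1), of "range v"] span by simp
  then have "surj T" using im span by simp
  then have "bij T"
    using T(1) by (simp add: bij_def linear_surjective_imp_injective)
  moreover have "T ` P = P"
    unfolding P convex_hull_linear_image[OF T(1)] im ..
  ultimately show ?thesis using T(1) by (simp add: Aut_GL_def)
qed

theorem theorem3p1:
  fixes P :: "(real^'d) set"
    and v :: "'n::finite \<Rightarrow> real^'d"
    and c :: "'n + 'n set \<Rightarrow> real"
  assumes "polytope P"
    and "affine hull P = UNIV"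
    and "0 \<in> interior P"
    and "bij_betw v UNIV {x. x extreme_point_of P}"
    and "\<forall>T \<in> carrier (Aut_GL P).
           induced_perm v T \<in> carrier (Aut_colored (edge_graph P v) c)"
    and "\<exists>\<theta>. is_eigenvalue (colored_adjacency (edge_graph P v) c) \<theta> \<and>
           span (columns (pinv (vertex_matrix v))) =
             eigenspace (colored_adjacency (edge_graph P v) c) \<theta>"
  shows "induced_perm v \<in> iso (Aut_GL P) (Aut_colored (edge_graph P v) c)"
proof -
  let ?E = "edge_graph P v"
  obtain \<theta> where U: "span (columns (pinv (vertex_matrix v))) =
             eigenspace (colored_adjacency ?E c) \<theta>" using assms(6) by blast
  have inj: "inj v" and rv: "range v = {x. x extreme_point_of P}"
    using assms(4) by (auto simp: bij_betw_def)
  have P: "P = convex hull range v"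
    unfolding rv using assms(1) by (simp add: Krein_Milman_Minkowski polytope_imp_compact polytope_imp_convex)
  \<comment> \<open>Full-dimensionality passes to the vertices: the affine hull of \<open>P\<close>
    lies in its linear span.\<close>
  have "P \<subseteq> span (range v)"
    using P convex_hull_subset_span by metis
  then have "span P \<subseteq> span (range v)"
    by (simp add: span_minimal)
  moreover have "span P = UNIV"
    using affine_hull_subset_span[of P] assms(2) by auto
  ultimately have span: "span (range v) = UNIV" by blast
  note act = induced_perm_vertex[OF assms(4)]
  have "induced_perm v (S \<circ> T) = induced_perm v S \<circ> induced_perm v T"
    if "S \<in> carrier (Aut_GL P)" "T \<in> carrier (Aut_GL P)" for S T
    using act[OF that(1)] act[OF that(2)] by (intro induced_perm_eqI[OF inj]) simp
  moreover have "mult (Aut_GL P) = (\<circ>)" "mult (Aut_colored ?E c) = (\<circ>)"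
    by (simp_all add: Aut_GL_def Aut_colored_def)
  ultimately have "induced_perm v \<in> hom (Aut_GL P) (Aut_colored ?E c)"
    using assms(5) by (intro homI) simp_all
  \<comment> \<open>A linear map is determined by its values on the spanning vertices.\<close>
  moreover have "inj_on (induced_perm v) (carrier (Aut_GL P))"
  proof (rule inj_onI)
    fix S T assume *: "S \<in> carrier (Aut_GL P)" "T \<in> carrier (Aut_GL P)"
      "induced_perm v S = induced_perm v T"
    then have "linear S" "linear T" by (auto simp: Aut_GL_def)
    moreover have "S x = T x" if "x \<in> range v" for x
      using that act[OF *(1)] act[OF *(2)] *(3) by auto
    ultimately show "S = T"
      using span linear_eq_on_span[of S T "range v"] by blast
  qed
  moreover have "\<sigma> \<in> induced_perm v ` carrier (Aut_GL P)"
    if s: "\<sigma> \<in> carrier (Aut_colored ?E c)" for \<sigma>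
  proof -
    obtain T where T: "linear T" "\<And>i. T (v i) = v (\<sigma> i)"
      using ex_linear_permuting[OF span U s] by blast
    have "bij \<sigma>" using s by (simp only: carrier_Aut_colored)
    with T have "T \<in> carrier (Aut_GL P)"
      by (intro linear_permuting_vertices_in_Aut_GL[OF P span])
    moreover have "\<sigma> = induced_perm v T"
      using induced_perm_eqI[OF inj, of T \<sigma>] T(2) by simp
    ultimately show ?thesis by blast
  qed
  ultimately show ?thesis
    using assms(5) unfolding iso_def bij_betw_def by blast
qed

end
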